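(* Assume the Continuum Hypothesis. Then there is $p\in P^*$ such that for every $n\geq 2$ there are $2^{\mathfrak{c}}$ ultrafilters $x\in\beta N$ with $x\supseteq F_n^p$.
   Context: $N=\{1,2,3,\dots\}$; $\beta N$ is the set of ultrafilters on $N$. $P$ is the set of prime numbers; $P^*$ is the set of nonprincipal ultrafilters $p\in\beta N$ with $P\in p$. For $p$ with $P\in p$, $p\restriction P=\{X\cap P: X\in p\}$. For $A\subseteq P$ and $n\in N$, $A^{(n)}$ is the set of all products $a_1a_2\cdots a_n$ of $n$ distinct elements of $A$. $F_n^p=\{A^{(n)}: A\in p\restriction P\}$. $\mathfrak{c}=2^{\aleph_0}$. *)

theory Defs
  imports "HOL-Computational_Algebra.Primes"
begin

unbundle cardinal_syntax

definition Npos :: "nat set" where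
  "Npos = {1..}"

definition ultrafilter_on :: "'a set \<Rightarrow> 'a set set \<Rightarrow> bool" where
  "ultrafilter_on S U \<longleftrightarrow>
     U \<subseteq> Pow S \<and> S \<in> U \<and> {} \<notin> U \<and>
     (\<forall>A\<in>U. \<forall>B\<in>U. A \<inter> B \<in> U) \<and>
     (\<forall>A\<in>U. \<forall>B. A \<subseteq> B \<and> B \<subseteq> S \<longrightarrow> B \<in> U) \<and>
     (\<forall>A. A \<subseteq> S \<longrightarrow> A \<in> U \<or> S - A \<in> U)"

definition betaN :: "nat set set set" where
  "betaN = {U. ultrafilter_on Npos U}"

definition principal_at :: "nat \<Rightarrow> nat set set" where
  "principal_at k = {A. A \<subseteq> Npos \<and> k \<in> A}"

definition primes :: "nat set" where
  "primes = {q. prime q}"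

definition primes_star :: "nat set set set" where
  "primes_star = {p \<in> betaN. primes \<in> p \<and> (\<forall>k\<in>Npos. p \<noteq> principal_at k)}"

definition restrict_uf :: "nat set set \<Rightarrow> nat set \<Rightarrow> nat set set" where
  "restrict_uf p Q = {X \<inter> Q | X. X \<in> p}"

definition distinct_prods :: "nat set \<Rightarrow> nat \<Rightarrow> nat set" where
  "distinct_prods A n = {\<Prod>B | B. B \<subseteq> A \<and> finite B \<and> card B = n}"

definition prod_family :: "nat \<Rightarrow> nat set set \<Rightarrow> nat set set" where
  "prod_family n p = {distinct_prods A n | A. A \<in> restrict_uf p primes}"

definition continuum :: "(nat \<Rightarrow> bool) rel" where
  "continuum = ctwo ^c natLeq"

text \<open>The cardinal equation \<open>\<aleph>\<^sub>1 = 2\<^bsup>\<aleph>\<^sub>0\<^esup>\<close>;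
  \<open>natLeq\<close> is the library's \<open>\<aleph>\<^sub>0\<close>, \<open>ctwo\<close> its cardinal 2.\<close>

definition continuum_hypothesis :: bool where
  "continuum_hypothesis \<longleftrightarrow> cardSuc natLeq =o continuum"

end

theory Submission
  imports Defs "HOL-Computational_Algebra.Squarefree" "HOL-Library.Countable_Set"
begin

text \<open>Identify the primes with the integers and colour a pair by a function of the 2-adic valuation
  of its difference, each of countably many colours being assigned to infinitely many valuations.
  A set missing some colour misses differences of arbitrarily large valuation \<open>d\<close>, so it meets at
  most one of the two halves of any residue class modulo \<open>2\<^sup>d\<close>; hence finitely many such sets never
  cover the integers, and some ultrafilter \<open>p\<close> contains no such set. Colouring a product of primes
  by its two least factors, every \<open>A\<^sup>(\<^sup>n\<^sup>)\<close> with \<open>A \<in> p\<close> then sees every colour, and an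
  independent family of continuum many subsets of the set of colours pulls back to \<open>2\<^sup>\<cc>\<close>
  ultrafilters.\<close>

section \<open>Ultrafilters from families with the finite intersection property\<close>

text \<open>Zorn's lemma gives a maximal family with the finite intersection property. The factor
  \<open>S\<close> in \<open>fip\<close> covers \<open>G = {}\<close>, whose intersection is
  \<open>UNIV\<close>, and so forces \<open>S \<noteq> {}\<close>.\<close>

lemma ultrafilter_extension:
  assumes "F \<subseteq> Pow S" and fip: "\<And>G. finite G \<Longrightarrow> G \<subseteq> F \<Longrightarrow> S \<inter> \<Inter>G \<noteq> {}"
  obtains U where "ultrafilter_on S U" "F \<subseteq> U"
proof -
  define P where "P = {H. F \<subseteq> H \<and> H \<subseteq> Pow S \<and> (\<forall>G. finite G \<longrightarrow> G \<subseteq> H \<longrightarrow> S \<inter> \<Inter>G \<noteq> {})}"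
  have "\<exists>M\<in>P. \<forall>X\<in>P. M \<subseteq> X \<longrightarrow> X = M"
  proof (rule subset_Zorn_nonempty)
    have "F \<in> P" using assms by (simp add: P_def)
    then show "P \<noteq> {}" by blast
  next
    fix C assume C: "C \<noteq> {}" "subset.chain P C"
    have CP: "C \<subseteq> P" using C(2) by (auto simp: subset.chain_def)
    have "S \<inter> \<Inter>G \<noteq> {}" if G: "finite G" "G \<subseteq> \<Union>C" for G
    proof -
      obtain H where "H \<in> C" "G \<subseteq> H"
        using finite_subset_Union_chain[OF G C] by blast
      then show ?thesis using CP G(1) by (auto simp: P_def)
    qed
    moreover have "F \<subseteq> H \<and> H \<subseteq> Pow S" if "H \<in> C" for H
      using subsetD[OF CP that] by (simp add: P_def)
    then have "F \<subseteq> \<Union>C" "\<Union>C \<subseteq> Pow S" using C(1) by blast+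
    ultimately show "\<Union>C \<in> P" by (simp add: P_def)
  qed
  then obtain U where U: "U \<in> P" and maxU: "\<And>X. X \<in> P \<Longrightarrow> U \<subseteq> X \<Longrightarrow> X = U" by blast
  have U_fip: "S \<inter> \<Inter>G \<noteq> {}" if "finite G" "G \<subseteq> U" for G using U that by (auto simp: P_def)
  \<comment> \<open>Maximality enters only here: a set compatible with all finite intersections of
    members could be adjoined, hence is a member already.\<close>
  have add: "A \<in> U" if A: "A \<subseteq> S" "\<And>G. finite G \<Longrightarrow> G \<subseteq> U \<Longrightarrow> S \<inter> A \<inter> \<Inter>G \<noteq> {}" for A
  proof -
    have "S \<inter> \<Inter>G \<noteq> {}" if G: "finite G" "G \<subseteq> insert A U" for G
    proof -
      have "S \<inter> A \<inter> \<Inter>(G - {A}) \<noteq> {}" using A(2)[of "G - {A}"] G by blast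
      then show ?thesis by blast
    qed
    then have "insert A U \<in> P" using U A(1) by (auto simp: P_def)
    then show ?thesis using maxU by blast
  qed
  have up: "B \<in> U" if "G \<subseteq> U" "finite G" "S \<inter> \<Inter>G \<subseteq> B" "B \<subseteq> S" for G B
  proof (rule add)
    fix G' assume "finite G'" "G' \<subseteq> U"
    then have "S \<inter> \<Inter>(G \<union> G') \<noteq> {}" using that by (intro U_fip) auto
    then show "S \<inter> B \<inter> \<Inter>G' \<noteq> {}" using that by blast
  qed (use that in auto)
  have UPow: "U \<subseteq> Pow S" using U by (auto simp: P_def)
  have "ultrafilter_on S U"
    unfolding ultrafilter_on_def
  proof (intro conjI ballI allI impI)
    show "U \<subseteq> Pow S" by (rule UPow)
    show "S \<in> U" by (rule up[of "{}"]) auto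
    show "{} \<notin> U" using U_fip[of "{{}}"] by auto
    show "A \<inter> B \<in> U" if "A \<in> U" "B \<in> U" for A B
      by (rule up[of "{A, B}"]) (use that UPow in auto)
    show "B \<in> U" if "A \<in> U" "A \<subseteq> B \<and> B \<subseteq> S" for A B
      by (rule up[of "{A}"]) (use that in auto)
    show "A \<in> U \<or> S - A \<in> U" if "A \<subseteq> S" for A
    proof (rule disjCI)
      assume "S - A \<notin> U"
      \<comment> \<open>By \<open>add\<close>, the obstruction to adjoining \<open>S - A\<close> is
        a finite intersection of members whose part in \<open>S\<close> lies inside
        \<open>A\<close>.\<close>
      then obtain G where G: "finite G" "G \<subseteq> U" "S \<inter> (S - A) \<inter> \<Inter>G = {}"
        using add[of "S - A"] by blast
      then show "A \<in> U" by (intro up[of G]) (use that in auto)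
    qed
  qed
  moreover have "F \<subseteq> U" using U by (auto simp: P_def)
  ultimately show thesis by (rule that)
qed

section \<open>An independent family over a countable index type\<close>

text \<open>The Hausdorff independent family: \<open>(k, L)\<close> stands for a bound together with a finite list of
  subsets of \<open>{..<k}\<close>.\<close>

definition indep_set :: "nat set \<Rightarrow> (nat \<times> nat list list) set" where
  "indep_set X = {(k, L). \<exists>l\<in>set L. set l = X \<inter> {..<k}}"

text \<open>Pick a point where \<open>X\<close> and \<open>Y\<close> differ for each of the finitely
  many pairs. Below a bound \<open>k\<close> exceeding all these points the traces still differ, so
  listing the traces of the members of \<open>\<X>\<close> produces \<open>d\<close>.\<close>

lemma indep_set_independent:
  assumes "finite \<X>" "finite \<Y>" "\<X> \<inter> \<Y> = {}"
  obtains d where "\<And>X. X \<in> \<X> \<Longrightarrow> d \<in> indep_set X" "\<And>Y. Y \<in> \<Y> \<Longrightarrow> d \<notin> indep_set Y"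
proof -
  have "\<exists>w. \<forall>X\<in>\<X>. \<forall>Y\<in>\<Y>. w X Y \<in> X \<longleftrightarrow> w X Y \<notin> Y"
  proof -
    have "\<forall>X Y. \<exists>w. X \<noteq> Y \<longrightarrow> (w \<in> X \<longleftrightarrow> w \<notin> (Y :: nat set))" by blast
    then obtain w where "\<And>X Y :: nat set. X \<noteq> Y \<Longrightarrow> w X Y \<in> X \<longleftrightarrow> w X Y \<notin> Y" by metis
    then show ?thesis using assms(3) by (metis disjoint_iff)
  qed
  then obtain w where w: "\<And>X Y. X \<in> \<X> \<Longrightarrow> Y \<in> \<Y> \<Longrightarrow> w X Y \<in> X \<longleftrightarrow> w X Y \<notin> Y" by blast
  have "finite ((\<lambda>(X, Y). w X Y) ` (\<X> \<times> \<Y>))" using assms by blast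
  then obtain k where k: "\<And>X Y. X \<in> \<X> \<Longrightarrow> Y \<in> \<Y> \<Longrightarrow> w X Y < k"
    unfolding finite_nat_set_iff_bounded by force
  obtain Xs where Xs: "set Xs = \<X>" using finite_list[OF assms(1)] by blast
  define L where "L = map (\<lambda>X. sorted_list_of_set (X \<inter> {..<k})) Xs"
  have L: "(k, L) \<in> indep_set Z \<longleftrightarrow> (\<exists>X\<in>\<X>. X \<inter> {..<k} = Z \<inter> {..<k})" for Z
    by (auto simp: indep_set_def L_def Xs)
  show thesis
  proof (rule that)
    show "(k, L) \<in> indep_set X" if "X \<in> \<X>" for X using L that by blast
    show "(k, L) \<notin> indep_set Y" if "Y \<in> \<Y>" for Y
      using L k w that by (metis Int_iff lessThan_iff)
  qed
qed

section \<open>Colouring pairs by 2-adic valuation\<close>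

text \<open>Each new set costs one refinement of the residue class already found. Missed valuations
  \<open>d\<close> beyond every \<open>m\<close> are required so that the refined class stays inside
  the old one.\<close>

lemma residue_class_avoiding:
  fixes \<A> :: "int set set"
  assumes "finite \<A>"
    and "\<And>A m. A \<in> \<A> \<Longrightarrow> \<exists>d\<ge>m. \<forall>a\<in>A. \<forall>b\<in>A. a \<noteq> b \<longrightarrow> multiplicity 2 (a - b) \<noteq> d"
  shows "\<exists>x m. \<forall>y. 2 ^ m dvd y - x \<longrightarrow> y \<notin> \<Union>\<A>"
  using assms
proof (induction \<A> rule: finite_induct)
  case empty
  then show ?case by simp
next
  case (insert A \<A>)
  then obtain x :: int and m where xm: "\<And>y. 2 ^ m dvd y - x \<Longrightarrow> y \<notin> \<Union>\<A>" by auto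
  obtain d where d: "d \<ge> m" "\<And>a b. a \<in> A \<Longrightarrow> b \<in> A \<Longrightarrow> a \<noteq> b \<Longrightarrow> multiplicity 2 (a - b) \<noteq> d"
    using insert.prems[of A m] by blast
  have near: "y \<notin> \<Union>\<A>" if "2 ^ d dvd y - x" for y
    using xm le_imp_power_dvd[OF d(1)] that dvd_trans by blast
  show ?case
  \<comment> \<open>The class of \<open>x\<close> modulo \<open>2 ^ d\<close> has two halves modulo
    \<open>2 ^ Suc d\<close>. The half of \<open>x\<close> is kept if \<open>A\<close> misses it;
    otherwise the half of \<open>x + 2 ^ d\<close> is taken.\<close>
  proof (cases "\<exists>a\<in>A. 2 ^ Suc d dvd a - x")
    case True
    then obtain a where a: "a \<in> A" "2 ^ Suc d dvd a - x" by blast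
    have "y \<notin> \<Union>(insert A \<A>)" if y: "2 ^ Suc d dvd y - (x + 2 ^ d)" for y
    proof -
      obtain s t where s: "a - x = 2 ^ Suc d * s" and t: "y - (x + 2 ^ d) = 2 ^ Suc d * t"
        using a y by (auto elim!: dvdE)
      \<comment> \<open>The odd cofactor shows that elements of opposite halves differ by valuation
        exactly \<open>d\<close>.\<close>
      have diff: "y - a = 2 ^ d * (2 * (t - s) + 1)" and yx: "y - x = 2 ^ d * (2 * t + 1)"
        using s t by (simp_all add: algebra_simps)
      have "\<not> 2 ^ Suc d dvd y - a"
        unfolding diff by (simp add: mult.commute[of 2] dvd_mult_cancel_left)
      moreover have "2 ^ d dvd y - a" unfolding diff by simp
      ultimately have "multiplicity 2 (y - a) = d" "y \<noteq> a" by (auto intro: multiplicity_eqI)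
      then have "y \<notin> A" using d(2)[of y a] a(1) by blast
      moreover have "y \<notin> \<Union>\<A>" using near yx by simp
      ultimately show ?thesis by simp
    qed
    then show ?thesis by blast
  next
    case False
    have "y \<notin> \<Union>(insert A \<A>)" if y: "2 ^ Suc d dvd y - x" for y
      using False near[of y] y dvd_trans[OF le_imp_power_dvd[of d "Suc d" 2] y] by auto
    then show ?thesis by blast
  qed
qed

text \<open>A set missing a colour misses every valuation carrying that colour, and these are
  unbounded, so \<open>residue_class_avoiding\<close> applies after transport to the
  integers.\<close>

lemma pair_colouring:
  fixes S :: "nat set"
  assumes "infinite S"
  obtains col :: "nat \<Rightarrow> nat \<Rightarrow> 'c::countable" where
    "\<forall>\<A>. finite \<A> \<and> (\<forall>A\<in>\<A>. \<exists>c. \<forall>a\<in>A. \<forall>b\<in>A. a < b \<longrightarrow> col a b \<noteq> c) \<longrightarrow>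
      S - \<Union>\<A> \<noteq> {}"
proof -
  define e :: "nat \<Rightarrow> int" where "e = from_nat_into UNIV \<circ> to_nat_on S"
  have e: "bij_betw e S UNIV"
    unfolding e_def using assms
    by (intro bij_betw_trans[OF to_nat_on_infinite] bij_betw_from_nat_into) (auto simp: infinite_UNIV_int)
  \<comment> \<open>Only the first component of the decoded pair determines the colour; the free
    second component makes each colour recur beyond any bound.\<close>
  define g :: "nat \<Rightarrow> 'c" where "g n = from_nat (fst (prod_decode n))" for n
  have g: "\<exists>n\<ge>m. g n = c" for m c
    by (rule exI[of _ "prod_encode (to_nat c, m)"]) (simp add: g_def le_prod_encode_2)
  define col where "col a b = g (multiplicity 2 (e a - e b))" for a b
  show thesis
  proof (rule that[of col], intro allI impI)
    fix \<A> :: "nat set set"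
    assume "finite \<A> \<and> (\<forall>A\<in>\<A>. \<exists>c. \<forall>a\<in>A. \<forall>b\<in>A. a < b \<longrightarrow> col a b \<noteq> c)"
    then have fin: "finite \<A>"
      and miss: "\<And>A. A \<in> \<A> \<Longrightarrow> \<exists>c. \<forall>a\<in>A. \<forall>b\<in>A. a < b \<longrightarrow> col a b \<noteq> c" by auto
    have "\<exists>x m. \<forall>y. 2 ^ m dvd y - x \<longrightarrow> y \<notin> \<Union>((`) e ` \<A>)"
    proof (rule residue_class_avoiding)
      show "finite ((`) e ` \<A>)" using fin by simp
      fix B m assume "B \<in> (`) e ` \<A>"
      then obtain A where A: "A \<in> \<A>" "B = e ` A" by blast
      obtain c where c: "\<And>a b. a \<in> A \<Longrightarrow> b \<in> A \<Longrightarrow> a < b \<Longrightarrow> col a b \<noteq> c" using miss[OF A(1)] by blast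
      obtain d where d: "d \<ge> m" "g d = c" using g by blast
      have "multiplicity 2 (e a - e b) \<noteq> d" if "a \<in> A" "b \<in> A" "e a \<noteq> e b" for a b
      \<comment> \<open>Missing a colour is a condition on increasing pairs only, and
        \<open>e\<close> need not preserve order; the sign of a difference does not affect its
        valuation.\<close>
      proof (cases "a < b")
        case True
        then show ?thesis using c[of a b] that d by (auto simp: col_def)
      next
        case False
        then have "b < a" using that by (metis linorder_neqE_nat)
        then have "multiplicity 2 (e b - e a) \<noteq> d" using c[of b a] that d by (auto simp: col_def)
        then show ?thesis using multiplicity_uminus_right[of 2 "e a - e b"] by simp
      qed
      then show "\<exists>d\<ge>m. \<forall>a\<in>B. \<forall>b\<in>B. a \<noteq> b \<longrightarrow> multiplicity 2 (a - b) \<noteq> d"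
        using d(1) A(2) by blast
    qed
    then obtain x where x: "x \<notin> \<Union>((`) e ` \<A>)" by (metis diff_self dvd_0_right)
    obtain s where "s \<in> S" "e s = x" using bij_betw_imp_surj_on[OF e] by (metis UNIV_I imageE)
    then show "S - \<Union>\<A> \<noteq> {}" using x by blast
  qed
qed

section \<open>An ultrafilter whose members see every colour\<close>

lemma ultrafilter_on_Int:
  "ultrafilter_on S U \<Longrightarrow> A \<in> U \<Longrightarrow> B \<in> U \<Longrightarrow> A \<inter> B \<in> U"
  by (simp add: ultrafilter_on_def)

lemma ultrafilter_on_disjoint:
  "ultrafilter_on S U \<Longrightarrow> A \<in> U \<Longrightarrow> B \<in> U \<Longrightarrow> A \<inter> B \<noteq> {}"
  by (metis ultrafilter_on_def)

text \<open>The complements in \<open>primes\<close> of colour-missing sets have the finite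
  intersection property by \<open>pair_colouring\<close>; an ultrafilter containing them has no
  colour-missing member.\<close>

lemma rainbow_ultrafilter:
  obtains p and col :: "nat \<Rightarrow> nat \<Rightarrow> 'c::countable" where
    "ultrafilter_on Npos p" "primes \<in> p"
    "\<forall>A\<in>p. \<forall>c. \<exists>a\<in>A. \<exists>b\<in>A. a < b \<and> col a b = c"
proof -
  have "infinite primes" using primes_infinite by (simp add: primes_def)
  then obtain col :: "nat \<Rightarrow> nat \<Rightarrow> 'c" where col:
    "\<forall>\<A>. finite \<A> \<and> (\<forall>A\<in>\<A>. \<exists>c. \<forall>a\<in>A. \<forall>b\<in>A. a < b \<longrightarrow> col a b \<noteq> c) \<longrightarrow>
      primes - \<Union>\<A> \<noteq> {}"
    by (rule pair_colouring)
  define small where "small A \<longleftrightarrow> (\<exists>c. \<forall>a\<in>A. \<forall>b\<in>A. a < b \<longrightarrow> col a b \<noteq> c)" for A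
  have primes_Npos: "primes \<subseteq> Npos" by (auto simp: primes_def Npos_def Suc_le_eq prime_gt_0_nat)
  obtain p where p: "ultrafilter_on Npos p" "(\<lambda>A. primes - A) ` Collect small \<subseteq> p"
  proof (rule ultrafilter_extension[of "(\<lambda>A. primes - A) ` Collect small" Npos])
    show "(\<lambda>A. primes - A) ` Collect small \<subseteq> Pow Npos" using primes_Npos by blast
    fix G assume "finite G" "G \<subseteq> (\<lambda>A. primes - A) ` Collect small"
    then obtain \<A> where \<A>: "\<A> \<subseteq> Collect small" "finite \<A>" "G = (\<lambda>A. primes - A) ` \<A>"
      by (rule finite_subset_image[THEN exE]) auto
    then have "primes - \<Union>\<A> \<noteq> {}" by (intro col[rule_format]) (auto simp: small_def)
    then show "Npos \<inter> \<Inter>G \<noteq> {}" using primes_Npos \<A>(3) by blast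
  qed
  show thesis
  proof (rule that[OF p(1)], safe)
    \<comment> \<open>The complement of the empty set is \<open>primes\<close> itself.\<close>
    have "small {}" by (simp add: small_def)
    then show "primes \<in> p" using p(2) by force
    show "\<exists>a\<in>A. \<exists>b\<in>A. a < b \<and> col a b = c" if "A \<in> p" for A c
    proof (rule ccontr)
      assume "\<not> ?thesis"
      then have "small (A \<inter> primes)" "small A" by (auto simp: small_def)
      then have "primes - A \<in> p" using p(2) by blast
      then show False using ultrafilter_on_disjoint[OF p(1) that] by blast
    qed
  qed
qed

section \<open>Colouring products of primes\<close>

text \<open>Intended for numbers with at least two prime factors. With fewer, a \<open>Min\<close>
  of the empty set occurs and the value is unspecified, which is harmless for products of
  \<open>n \<ge> 2\<close> distinct primes.\<close>

definition least_factors_colour :: "(nat \<Rightarrow> nat \<Rightarrow> 'c) \<Rightarrow> nat \<Rightarrow> 'c" where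
  "least_factors_colour col y =
     (let a = Min (prime_factors y) in col a (Min (prime_factors y - {a})))"

lemma prime_factors_prod_primes:
  assumes "finite B" "B \<subseteq> primes"
  shows "prime_factors (\<Prod>B) = B"
proof -
  have pr: "prime q" if "q \<in> B" for q using assms that by (auto simp: primes_def)
  have "prime_factors (\<Prod>B) = \<Union>((prime_factors \<circ> (\<lambda>q. q)) ` B)"
    using assms(1) pr by (intro prime_factors_prod) (auto dest: prime_gt_0_nat)
  also have "\<dots> = B" using pr by (auto simp: prime_prime_factors)
  finally show ?thesis .
qed

text \<open>Since \<open>A\<close> is infinite, the other \<open>n - 2\<close> factors can be chosen
  above \<open>b\<close>, leaving \<open>a\<close> and \<open>b\<close> as the two least.\<close>

lemma distinct_prods_colour:
  assumes "infinite A" "A \<subseteq> primes" "a \<in> A" "b \<in> A" "a < b" "n \<ge> 2"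
  obtains y where "y \<in> distinct_prods A n" "least_factors_colour col y = col a b"
proof -
  have "A \<subseteq> (A \<inter> {b<..}) \<union> {..b}" by auto
  then have "infinite (A \<inter> {b<..})" using assms(1) by (meson finite_Un finite_atMost finite_subset)
  then obtain C where C: "C \<subseteq> A \<inter> {b<..}" "finite C" "card C = n - 2"
    using infinite_arbitrarily_large by blast
  define B where "B = insert a (insert b C)"
  have notin: "a \<notin> insert b C" "b \<notin> C" using C(1) assms(5) by auto
  have B: "finite B" "B \<subseteq> A" "card B = n" using C assms notin by (auto simp: B_def)
  have pf: "prime_factors (\<Prod>B) = B" using B assms(2) by (intro prime_factors_prod_primes) auto
  have "Min B = a" by (rule Min_eqI) (use B C assms(5) in \<open>auto simp: B_def\<close>)
  moreover have "Min (B - {a}) = b" by (rule Min_eqI) (use B C assms(5) in \<open>auto simp: B_def\<close>)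
  ultimately have col: "least_factors_colour col (\<Prod>B) = col a b"
    by (simp add: least_factors_colour_def pf)
  have "\<Prod>B \<in> distinct_prods A n" using B by (auto simp: distinct_prods_def)
  then show thesis using col by (rule that)
qed

lemma distinct_prods_mono: "A \<subseteq> B \<Longrightarrow> distinct_prods A n \<subseteq> distinct_prods B n"
  by (auto simp: distinct_prods_def)

lemma distinct_prods_Npos: "A \<subseteq> primes \<Longrightarrow> distinct_prods A n \<subseteq> Npos"
proof
  fix y assume A: "A \<subseteq> primes" and "y \<in> distinct_prods A n"
  then obtain B where B: "B \<subseteq> A" "y = \<Prod>B" by (auto simp: distinct_prods_def)
  have "\<Prod>B > 0" using A B(1) by (intro prod_pos) (auto simp: primes_def prime_gt_0_nat)
  then show "y \<in> Npos" by (simp add: B(2) Npos_def)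
qed

section \<open>Counting the ultrafilters\<close>

text \<open>This form of the cardinal serves both bounds: the type \<open>nat set set\<close>
  contains all ultrafilters and also indexes the ones constructed below.\<close>

lemma cexp_ctwo_continuum: "ctwo ^c continuum =o |UNIV :: nat set set set|"
proof -
  have "ctwo ^c continuum = |UNIV :: ((nat \<Rightarrow> bool) \<Rightarrow> bool) set|"
    by (simp add: continuum_def cexp_def Field_card_of Func_def ctwo_def Field_natLeq)
  moreover have "bij (\<lambda>h. {X. h (\<lambda>i. i \<in> X)} :: nat set set)"
  proof (rule bij_betw_byWitness[where f' = "\<lambda>F h. Collect h \<in> F"])
  qed auto
  ultimately show ?thesis by (metis card_of_ordIsoI)
qed

theorem theorem3p13:
  assumes "continuum_hypothesis"
  shows "\<exists>p \<in> primes_star. \<forall>n\<ge>2. |{x \<in> betaN. prod_family n p \<subseteq> x}| =o ctwo ^c continuum"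
proof -
  \<comment> \<open>Colours are the indices of the independent family; encoding by lists makes their
    type an instance of \<open>countable\<close>.\<close>
  obtain p and col :: "nat \<Rightarrow> nat \<Rightarrow> nat \<times> nat list list" where
    p: "ultrafilter_on Npos p" "primes \<in> p"
    and all_colours: "\<forall>A\<in>p. \<forall>c. \<exists>a\<in>A. \<exists>b\<in>A. a < b \<and> col a b = c"
    by (rule rainbow_ultrafilter)
  have colours: "\<exists>a\<in>A. \<exists>b\<in>A. a < b \<and> col a b = c" if "A \<in> p" for A c
    using all_colours that by blast
  have "p \<noteq> principal_at k" if "k \<in> Npos" for k
    using colours[of "{k}"] that by (auto simp: principal_at_def)
  then have star: "p \<in> primes_star" using p by (simp add: primes_star_def betaN_def)
  have inf: "infinite A" if "A \<in> p" for A
  proof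
    assume "finite A"
    \<comment> \<open>A finite \<open>A\<close> has finitely many pairs, yet they would have to
      realise infinitely many colours.\<close>
    moreover have "c \<in> (\<lambda>(a, b). col a b) ` (A \<times> A)" for c using colours[OF that, of c] by force
    then have "UNIV \<subseteq> (\<lambda>(a, b). col a b) ` (A \<times> A)" by blast
    ultimately have "finite (UNIV :: (nat \<times> nat list list) set)"
      by (meson finite_SigmaI finite_imageI finite_subset)
    then show False by (simp add: finite_prod)
  qed
  have restrict_iff: "A \<in> restrict_uf p primes \<longleftrightarrow> A \<in> p \<and> A \<subseteq> primes" for A
  proof
    assume "A \<in> restrict_uf p primes"
    then obtain X where "X \<in> p" "A = X \<inter> primes" by (auto simp: restrict_uf_def)
    then show "A \<in> p \<and> A \<subseteq> primes" using ultrafilter_on_Int[OF p(1) _ p(2)] by simp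
  next
    assume "A \<in> p \<and> A \<subseteq> primes"
    then show "A \<in> restrict_uf p primes" unfolding restrict_uf_def by blast
  qed
  have restrict: "A \<in> p" "A \<subseteq> primes" if "A \<in> restrict_uf p primes" for A
    using that by (simp_all add: restrict_iff)
  have restrict_Int: "A \<inter> B \<in> restrict_uf p primes"
    if "A \<in> restrict_uf p primes" "B \<in> restrict_uf p primes" for A B
    using that ultrafilter_on_Int[OF p(1)] by (auto simp: restrict_iff)
  have primes_restrict: "primes \<in> restrict_uf p primes" using p(2) by (simp add: restrict_iff)
  have "|{x \<in> betaN. prod_family n p \<subseteq> x}| =o ctwo ^c continuum" if n: "n \<ge> 2" for n
  proof -
    define T where "T X = {y \<in> Npos. least_factors_colour col y \<in> indep_set X}" for X
    \<comment> \<open>\<open>Fam F\<close> decides every \<open>T X\<close>: it is put in for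
      \<open>X \<in> F\<close> and its complement is put in otherwise.\<close>
    define Fam where "Fam F = prod_family n p \<union> T ` F \<union> (\<lambda>X. Npos - T X) ` (- F)" for F
    have "\<exists>U. ultrafilter_on Npos U \<and> Fam F \<subseteq> U" for F
    proof -
      have Pow: "Fam F \<subseteq> Pow Npos"
        using distinct_prods_Npos[OF restrict(2)] by (auto simp: Fam_def prod_family_def T_def)
      have "Npos \<inter> \<Inter>G \<noteq> {}" if "finite G" "G \<subseteq> Fam F" for G
      proof -
        \<comment> \<open>Normal form of a finite subfamily: one \<open>A\<close>, since members of
          the restriction intersect, plus finitely many positive and negative conditions on the
          colour.\<close>
        have "\<exists>A \<X> \<Y>. A \<in> restrict_uf p primes \<and> finite \<X> \<and> finite \<Y> \<and> \<X> \<subseteq> F \<and> \<Y> \<subseteq> - F \<and>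
            (\<forall>y\<in>distinct_prods A n. (\<forall>X\<in>\<X>. y \<in> T X) \<longrightarrow> (\<forall>Y\<in>\<Y>. y \<notin> T Y) \<longrightarrow> y \<in> \<Inter>G)"
          using that
        proof (induction G rule: finite_induct)
          case empty
          show ?case using primes_restrict by (intro exI[of _ primes] exI[of _ "{}"]) simp
        next
          case (insert Z G)
          then obtain A \<X> \<Y> where IH: "A \<in> restrict_uf p primes" "finite \<X>" "finite \<Y>" "\<X> \<subseteq> F" "\<Y> \<subseteq> - F"
            "\<And>y. y \<in> distinct_prods A n \<Longrightarrow> \<forall>X\<in>\<X>. y \<in> T X \<Longrightarrow> \<forall>Y\<in>\<Y>. y \<notin> T Y \<Longrightarrow> y \<in> \<Inter>G"
            by (metis insert_subset)
          have Npos_A: "y \<in> Npos" if "y \<in> distinct_prods A n" for y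
            using distinct_prods_Npos[OF restrict(2)[OF IH(1)]] that by blast
          have Z: "y \<in> \<Inter>(insert Z G)"
            if "y \<in> distinct_prods A n" "\<forall>X\<in>\<X>. y \<in> T X" "\<forall>Y\<in>\<Y>. y \<notin> T Y" "y \<in> Z" for y
            using IH(6)[OF that(1-3)] that(4) by blast
          have "Z \<in> Fam F" using insert.prems by simp
          then consider A' where "A' \<in> restrict_uf p primes" "Z = distinct_prods A' n"
            | X where "X \<in> F" "Z = T X" | Y where "Y \<in> - F" "Z = Npos - T Y"
            by (auto simp: Fam_def prod_family_def)
          then show ?case
          proof cases
            case 1
            have "y \<in> distinct_prods A n" "y \<in> Z" if "y \<in> distinct_prods (A \<inter> A') n" for y
              using that 1(2) distinct_prods_mono[of "A \<inter> A'" A n] distinct_prods_mono[of "A \<inter> A'" A' n]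
              by auto
            then have "\<forall>y\<in>distinct_prods (A \<inter> A') n.
                (\<forall>X\<in>\<X>. y \<in> T X) \<longrightarrow> (\<forall>Y\<in>\<Y>. y \<notin> T Y) \<longrightarrow> y \<in> \<Inter>(insert Z G)"
              using Z by blast
            then show ?thesis using IH(2-5) restrict_Int[OF IH(1) 1(1)] by blast
          next
            case 2
            have "\<forall>y\<in>distinct_prods A n.
                (\<forall>X\<in>insert X \<X>. y \<in> T X) \<longrightarrow> (\<forall>Y\<in>\<Y>. y \<notin> T Y) \<longrightarrow> y \<in> \<Inter>(insert Z G)"
              using Z 2(2) by blast
            moreover have "finite (insert X \<X>)" "insert X \<X> \<subseteq> F" using IH(2,4) 2(1) by simp_all
            ultimately show ?thesis using IH(1,3,5) by blast
          next
            case 3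
            have "\<forall>y\<in>distinct_prods A n.
                (\<forall>X\<in>\<X>. y \<in> T X) \<longrightarrow> (\<forall>Y\<in>insert Y \<Y>. y \<notin> T Y) \<longrightarrow> y \<in> \<Inter>(insert Z G)"
              using Z 3(2) Npos_A by blast
            moreover have "finite (insert Y \<Y>)" "insert Y \<Y> \<subseteq> - F" using IH(3,5) 3(1) by simp_all
            ultimately show ?thesis using IH(1,2,4) by blast
          qed
        qed
        then obtain A \<X> \<Y> where A: "A \<in> restrict_uf p primes" and fin: "finite \<X>" "finite \<Y>"
          and F: "\<X> \<subseteq> F" "\<Y> \<subseteq> - F"
          and sub: "\<forall>y\<in>distinct_prods A n. (\<forall>X\<in>\<X>. y \<in> T X) \<longrightarrow> (\<forall>Y\<in>\<Y>. y \<notin> T Y) \<longrightarrow> y \<in> \<Inter>G"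
          by blast
        have "\<X> \<inter> \<Y> = {}" using F by blast
        then obtain d where d: "\<And>X. X \<in> \<X> \<Longrightarrow> d \<in> indep_set X" "\<And>Y. Y \<in> \<Y> \<Longrightarrow> d \<notin> indep_set Y"
          using indep_set_independent[OF fin] by blast
        \<comment> \<open>The colour \<open>d\<close> meets all conditions; it occurs on a pair in
          \<open>A\<close>, hence on a product of \<open>n\<close> elements of
          \<open>A\<close>.\<close>
        obtain a b where ab: "a \<in> A" "b \<in> A" "a < b" "col a b = d"
          using colours[OF restrict(1)[OF A]] by blast
        obtain y where y: "y \<in> distinct_prods A n" "least_factors_colour col y = d"
          using distinct_prods_colour[OF inf[OF restrict(1)[OF A]] restrict(2)[OF A] ab(1-3) n] ab(4)
          by metis
        have yN: "y \<in> Npos" using y(1) distinct_prods_Npos[OF restrict(2)[OF A]] by blast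
        then have "\<forall>X\<in>\<X>. y \<in> T X" "\<forall>Y\<in>\<Y>. y \<notin> T Y" using d y(2) by (simp_all add: T_def)
        then have "y \<in> \<Inter>G" using sub y(1) by blast
        then show ?thesis using yN by blast
      qed
      then show ?thesis using ultrafilter_extension[OF Pow] by metis
    qed
    then obtain U where U: "\<And>F. ultrafilter_on Npos (U F)" "\<And>F. Fam F \<subseteq> U F" by metis
    have TU: "T X \<in> U F \<longleftrightarrow> X \<in> F" for X F
    proof
      show "X \<in> F \<Longrightarrow> T X \<in> U F" using U(2) by (auto simp: Fam_def)
      show "X \<in> F" if "T X \<in> U F"
      proof (rule ccontr)
        assume "X \<notin> F"
        then have "Npos - T X \<in> U F" using U(2)[of F] by (auto simp: Fam_def)
        then show False using ultrafilter_on_disjoint[OF U(1) that] by blast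
      qed
    qed
    \<comment> \<open>\<open>F\<close> is recovered from \<open>U F\<close> as the set of all
      \<open>X\<close> with \<open>T X \<in> U F\<close>.\<close>
    have "inj U" by (rule injI) (metis TU subsetI subset_antisym)
    moreover have "range U \<subseteq> {x \<in> betaN. prod_family n p \<subseteq> x}"
      using U(1) U(2)[unfolded Fam_def] unfolding betaN_def by blast
    ultimately have "|UNIV :: nat set set set| \<le>o |{x \<in> betaN. prod_family n p \<subseteq> x}|"
      using card_of_ordLeq by blast
    \<comment> \<open>The upper bound is mere inclusion in the type
      \<open>nat set set\<close>.\<close>
    then have "|{x \<in> betaN. prod_family n p \<subseteq> x}| =o |UNIV :: nat set set set|"
      by (simp add: ordIso_iff_ordLeq card_of_mono1)
    then show ?thesis using cexp_ctwo_continuum ordIso_symmetric ordIso_transitive by blast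
  qed
  then show ?thesis using star by blast
qed

end
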